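(* Let $\dot{\boldsymbol{x}}=\boldsymbol{f}(\boldsymbol{x})$ be an autonomous ODE in $\mathbb{R}^n$ possessing an affine second integral $p(\boldsymbol{x})=\boldsymbol{p}^T\boldsymbol{x}$, $\boldsymbol{p}\in\mathbb{R}^n$, with cofactor $c(\boldsymbol{x})$, i.e. $\boldsymbol{p}^T\boldsymbol{f}(\boldsymbol{x})=c(\boldsymbol{x})\,\boldsymbol{p}^T\boldsymbol{x}$. Let $\varphi_h$ be the map of any $s$-stage Runge-Kutta method with coefficients $\mathcal{A}\in\mathbb{R}^{s\times s}$, $\boldsymbol{b}\in\mathbb{R}^s$ applied to this ODE, with stages $\boldsymbol{g}_1,\dots,\boldsymbol{g}_s$. Then $\boldsymbol{p}^T\boldsymbol{x}$ is a discrete second integral of $\varphi_h$: $$\boldsymbol{p}^T\varphi_h(\boldsymbol{x})=\tilde c(\boldsymbol{x})\,\boldsymbol{p}^T\boldsymbol{x},$$ where the discrete cofactor is $$\tilde c(\boldsymbol{x})=1+h\,\boldsymbol{b}^TD_c\,(I-h\mathcal{A}D_c)^{-1}\mathbb{1},\qquad D_c=\mathrm{diag}(c(\boldsymbol{g}_1),\dots,c(\boldsymbol{g}_s))\in\mathbb{R}^{s\times s},$$ and $\mathbb{1}\in\mathbb{R}^s$ is the vector of ones.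
   Context: A second integral of $\dot{\boldsymbol{x}}=\boldsymbol{f}(\boldsymbol{x})$ is a function $p$ satisfying $\boldsymbol{f}(\boldsymbol{x})^T\nabla p(\boldsymbol{x})=c(\boldsymbol{x})p(\boldsymbol{x})$; $c$ is its cofactor. An $s$-stage Runge-Kutta method with coefficients $\mathcal{A}=[a_{ij}]$, $\boldsymbol{b}=(b_1,\dots,b_s)^T$ and time step $h$ applied to $\dot{\boldsymbol{x}}=\boldsymbol{f}(\boldsymbol{x})$ defines the map $\varphi_h$ by $$\boldsymbol{g}_i=\boldsymbol{x}+h\sum_{j=1}^s a_{ij}\boldsymbol{f}(\boldsymbol{g}_j)\quad(i=1,\dots,s),\qquad \varphi_h(\boldsymbol{x})=\boldsymbol{x}+h\sum_{j=1}^s b_j\boldsymbol{f}(\boldsymbol{g}_j).$$ Convention: $\boldsymbol{f}$ and $c$ are continuously differentiable on an open set $U\subseteq\mathbb{R}^n$; for each $\boldsymbol{x}\in U$, $|h|$ is taken sufficiently small (depending on $\boldsymbol{x}$), and the stages are the solution of the stage equations near $\boldsymbol{x}$ (with $\boldsymbol{g}_i\to\boldsymbol{x}$ as $h\to0$), so that the stages lie in $U$ and the matrix $I-h\mathcal{A}D_c$ is invertible. *)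

theory Defs
  imports "HOL-Analysis.Analysis"
begin

definition continuously_differentiable_on ::
    "'a::real_normed_vector set \<Rightarrow> ('a \<Rightarrow> 'b::real_normed_vector) \<Rightarrow> bool" where
  "continuously_differentiable_on U f \<longleftrightarrow>
     (\<exists>f' :: 'a \<Rightarrow> 'a \<Rightarrow>\<^sub>L 'b.
        (\<forall>x\<in>U. (f has_derivative blinfun_apply (f' x)) (at x)) \<and> continuous_on U f')"

text \<open>The vector \<open>q'\<close> below is the gradient of \<open>q\<close> at \<open>x\<close>.\<close>

definition second_integral ::
    "'a::real_inner set \<Rightarrow> ('a \<Rightarrow> 'a) \<Rightarrow> ('a \<Rightarrow> real) \<Rightarrow> ('a \<Rightarrow> real) \<Rightarrow> bool" where
  "second_integral U f q c \<longleftrightarrow>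
     (\<forall>x\<in>U. \<exists>q'. (GDERIV q x :> q') \<and> f x \<bullet> q' = c x * q x)"

text \<open>The finite type \<open>'s\<close> indexes the stages. A tuple of stages is a vector \<open>G\<close> whose
  \<open>i\<close>-th entry \<open>G $ i\<close> is the \<open>i\<close>-th stage.\<close>

definition rk_stages ::
    "real ^ 's ^ 's \<Rightarrow> (real ^ 'n \<Rightarrow> real ^ 'n) \<Rightarrow> real \<Rightarrow> real ^ 'n \<Rightarrow> real ^ 'n ^ 's \<Rightarrow> bool" where
  "rk_stages A f h x G \<longleftrightarrow>
     (\<forall>i. G $ i = x + h *\<^sub>R (\<Sum>j\<in>UNIV. A $ i $ j *\<^sub>R f (G $ j)))"

definition rk_step ::
    "real ^ 's \<Rightarrow> (real ^ 'n \<Rightarrow> real ^ 'n) \<Rightarrow> real \<Rightarrow> real ^ 'n \<Rightarrow> real ^ 'n ^ 's \<Rightarrow> real ^ 'n" where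
  "rk_step b f h x G = x + h *\<^sub>R (\<Sum>j\<in>UNIV. b $ j *\<^sub>R f (G $ j))"

text \<open>The stage equations may have several solutions; the branch whose
  stages tend to \<open>x\<close> as \<open>h\<close> tends to \<open>0\<close> is the relevant one. It exists and is unique for
  all small \<open>h\<close>, see \<open>rk_method_exists\<close> and \<open>rk_method_unique\<close> below. Values outside the
  neighbourhood of \<open>h = 0\<close> (which may depend on \<open>x\<close>) are left arbitrary.\<close>

definition rk_stage_branch ::
    "real ^ 's ^ 's \<Rightarrow> (real ^ 'n \<Rightarrow> real ^ 'n) \<Rightarrow> real ^ 'n \<Rightarrow> (real \<Rightarrow> real ^ 'n ^ 's) \<Rightarrow> bool" where
  "rk_stage_branch A f x G \<longleftrightarrow>
     (\<forall>\<^sub>F h in nhds 0. rk_stages A f h x (G h)) \<and> (\<forall>i. ((\<lambda>h. G h $ i) \<longlongrightarrow> x) (at 0))"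

text \<open>\<open>\<phi> h\<close> is the Runge-Kutta map with time step \<open>h\<close>, and \<open>g h x\<close> are its stages at \<open>x\<close>.\<close>

definition rk_method ::
    "(real ^ 'n) set \<Rightarrow> real ^ 's ^ 's \<Rightarrow> real ^ 's \<Rightarrow> (real ^ 'n \<Rightarrow> real ^ 'n) \<Rightarrow>
     (real \<Rightarrow> real ^ 'n \<Rightarrow> real ^ 'n ^ 's) \<Rightarrow> (real \<Rightarrow> real ^ 'n \<Rightarrow> real ^ 'n) \<Rightarrow> bool" where
  "rk_method U A b f g \<phi> \<longleftrightarrow>
     (\<forall>x\<in>U. rk_stage_branch A f x (\<lambda>h. g h x) \<and>
             (\<forall>\<^sub>F h in nhds 0. \<phi> h x = rk_step b f h x (g h x)))"

definition diag :: "'a::zero ^ 's \<Rightarrow> 'a ^ 's ^ 's" where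
  "diag v = (\<chi> i j. if i = j then v $ i else 0)"

definition stage_diag :: "(real ^ 'n \<Rightarrow> real) \<Rightarrow> real ^ 'n ^ 's \<Rightarrow> real ^ 's ^ 's" where
  "stage_diag c G = diag (\<chi> i. c (G $ i))"

text \<open>The last factor \<open>1\<close> is the vector of ones in \<open>real ^ 's\<close>.\<close>

definition discrete_cofactor ::
    "real ^ 's ^ 's \<Rightarrow> real ^ 's \<Rightarrow> (real ^ 'n \<Rightarrow> real) \<Rightarrow> real \<Rightarrow> real ^ 'n ^ 's \<Rightarrow> real" where
  "discrete_cofactor A b c h G =
     1 + h * (b \<bullet> (stage_diag c G *v
                   (matrix_inv (mat 1 - h *\<^sub>R (A ** stage_diag c G)) *v 1)))"

lemma continuously_differentiable_on_bounds:
  fixes f :: "real ^ 'n \<Rightarrow> real ^ 'n"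
  assumes "continuously_differentiable_on U f" "cball x r \<subseteq> U"
  obtains L M where "L > 0" "M > 0" "\<And>y. y \<in> cball x r \<Longrightarrow> norm (f y) \<le> M"
    "\<And>y z. y \<in> cball x r \<Longrightarrow> z \<in> cball x r \<Longrightarrow> norm (f y - f z) \<le> L * norm (y - z)"
proof -
  from assms(1) obtain f' :: "real ^ 'n \<Rightarrow> (real ^ 'n) \<Rightarrow>\<^sub>L (real ^ 'n)" where
    f': "\<And>x. x \<in> U \<Longrightarrow> (f has_derivative blinfun_apply (f' x)) (at x)" and cont: "continuous_on U f'"
    unfolding continuously_differentiable_on_def by blast
  have "compact (f' ` cball x r)"
    by (meson assms(2) compact_cball compact_continuous_image cont continuous_on_subset)
  then obtain L where L: "L > 0" "\<And>y. y \<in> cball x r \<Longrightarrow> norm (f' y) \<le> L"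
    by (metis bounded_pos compact_imp_bounded image_eqI)
  have "continuous_on (cball x r) f"
    by (meson assms(2) continuous_at_imp_continuous_on f' has_derivative_continuous subsetD)
  then obtain M where M: "M > 0" "\<And>y. y \<in> cball x r \<Longrightarrow> norm (f y) \<le> M"
    by (metis bounded_pos compact_imp_bounded compact_continuous_image compact_cball image_eqI)
  have "norm (f y - f z) \<le> L * norm (y - z)" if "y \<in> cball x r" "z \<in> cball x r" for y z
  proof (rule differentiable_bound[where S = "cball x r" and f' = "\<lambda>x. blinfun_apply (f' x)"])
    show "(f has_derivative blinfun_apply (f' w)) (at w within cball x r)" if "w \<in> cball x r" for w
      using that assms(2) f' has_derivative_at_withinI by blast
    show "onorm (blinfun_apply (f' w)) \<le> L" if "w \<in> cball x r" for w
      using that L(2) by (simp flip: norm_blinfun.rep_eq)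
  qed (use that in auto)
  with L M that show ?thesis by blast
qed

lemma rk_stages_local:
  fixes f :: "real ^ 'n \<Rightarrow> real ^ 'n" and A :: "real ^ 's ^ 's"
  assumes cd: "continuously_differentiable_on U f" and U: "cball x r \<subseteq> U" and r: "r > 0"
  shows "\<forall>\<^sub>F h in nhds 0. \<exists>!G. G \<in> {G. \<forall>i. G $ i \<in> cball x r} \<and> rk_stages A f h x G"
proof -
  obtain L M where L: "L > 0" and M: "M > 0" and Mb: "\<And>y. y \<in> cball x r \<Longrightarrow> norm (f y) \<le> M"
    and Lb: "\<And>y z. y \<in> cball x r \<Longrightarrow> z \<in> cball x r \<Longrightarrow> norm (f y - f z) \<le> L * norm (y - z)"
    using continuously_differentiable_on_bounds[OF cd U] by metis
  define K where "K = 1 + (\<Sum>i\<in>UNIV. \<Sum>j\<in>UNIV. \<bar>A $ i $ j\<bar>)"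
  have K: "K > 0" unfolding K_def by (smt (verit) sum_nonneg abs_ge_zero)
  have Ki: "(\<Sum>j\<in>UNIV. \<bar>A $ i $ j\<bar>) \<le> K" for i
    using member_le_sum[of i UNIV "\<lambda>i. \<Sum>j\<in>UNIV. \<bar>A $ i $ j\<bar>"] unfolding K_def
    by (auto simp: sum_nonneg)
  define S where "S = {G :: real ^ 'n ^ 's. \<forall>i. G $ i \<in> cball x r}"
  have "S = (\<Inter>i. (\<lambda>G. G $ i) -` cball x r)" by (auto simp: S_def)
  then have "closed S"
    by (auto intro!: closed_INT continuous_closed_vimage continuous_intros)
  then have S: "complete S" by (simp add: complete_eq_closed)
  have S0: "S \<noteq> {}" using r by (auto simp: S_def intro!: exI[of _ "\<chi> i. x"])
  define h0 where "h0 = min (r / (K * M)) (1 / (2 * K * L))"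
  have h0: "h0 > 0" using r K L M by (simp add: h0_def)
  have "\<exists>!G. G \<in> S \<and> rk_stages A f h x G" if h: "\<bar>h\<bar> < h0" for h
  proof -
    define F where "F G = (\<chi> i. x + h *\<^sub>R (\<Sum>j\<in>UNIV. A $ i $ j *\<^sub>R f (G $ j)))"
      for G :: "real ^ 'n ^ 's"
    have hM: "\<bar>h\<bar> * (K * M) \<le> r" using h K M by (simp add: h0_def field_simps)
    have hL: "\<bar>h\<bar> * (K * L) \<le> 1 / 2" using h K L by (simp add: h0_def field_simps)
    have maps: "F ` S \<subseteq> S"
    proof clarify
      fix G assume G: "G \<in> S"
      have "norm (\<Sum>j\<in>UNIV. A $ i $ j *\<^sub>R f (G $ j)) \<le> K * M" for i
      proof -
        have "norm (\<Sum>j\<in>UNIV. A $ i $ j *\<^sub>R f (G $ j)) \<le> (\<Sum>j\<in>UNIV. \<bar>A $ i $ j\<bar> * M)"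
          using G Mb unfolding S_def by (intro sum_norm_le) (auto intro: mult_left_mono)
        also have "\<dots> = (\<Sum>j\<in>UNIV. \<bar>A $ i $ j\<bar>) * M" by (simp add: sum_distrib_right)
        also have "\<dots> \<le> K * M" using Ki M by (intro mult_right_mono) auto
        finally show ?thesis .
      qed
      then have "\<bar>h\<bar> * norm (\<Sum>j\<in>UNIV. A $ i $ j *\<^sub>R f (G $ j)) \<le> r" for i
        using hM by (meson abs_ge_zero mult_left_mono order_trans)
      then show "F G \<in> S" by (simp add: S_def F_def dist_norm)
    qed
    have contr: "dist (F G) (F G') \<le> 1 / 2 * dist G G'" if G: "G \<in> S" "G' \<in> S" for G G'
    proof -
      have comp: "norm (f (G $ j) - f (G' $ j)) \<le> L * dist G G'" for j
      proof -
        have "norm (f (G $ j) - f (G' $ j)) \<le> L * norm (G $ j - G' $ j)"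
          using G by (intro Lb) (auto simp: S_def)
        also have "\<dots> \<le> L * dist G G'"
          using L dist_vec_nth_le[of G j G'] by (simp add: dist_norm)
        finally show ?thesis .
      qed
      have "dist (F G) (F G') \<le> (\<Sum>i\<in>UNIV. norm ((F G - F G') $ i))"
        unfolding dist_norm norm_vec_def by (intro L2_set_le_sum) auto
      also have "\<dots> = (\<Sum>i\<in>UNIV. \<bar>h\<bar> * norm (\<Sum>j\<in>UNIV. A $ i $ j *\<^sub>R (f (G $ j) - f (G' $ j))))"
        by (simp add: F_def scaleR_diff_right sum_subtractf flip: norm_scaleR)
      also have "\<dots> \<le> (\<Sum>i\<in>UNIV. \<bar>h\<bar> * (\<Sum>j\<in>UNIV. \<bar>A $ i $ j\<bar> * (L * dist G G')))"
        using comp by (intro sum_mono mult_left_mono sum_norm_le) (auto intro: mult_left_mono)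
      also have "\<dots> = \<bar>h\<bar> * ((K - 1) * (L * dist G G'))"
        by (simp add: K_def sum_distrib_left sum_distrib_right)
      also have "\<dots> \<le> \<bar>h\<bar> * (K * (L * dist G G'))"
        using L by (intro mult_left_mono mult_right_mono) auto
      also have "\<dots> = \<bar>h\<bar> * (K * L) * dist G G'" by simp
      also have "\<dots> \<le> 1 / 2 * dist G G'" using hL by (intro mult_right_mono) auto
      finally show ?thesis .
    qed
    have "\<exists>!G. G \<in> S \<and> F G = G"
      using Banach_fix[OF S S0 _ _ maps, of "1/2"] contr by auto
    moreover have "rk_stages A f h x G \<longleftrightarrow> F G = G" for G
      by (auto simp: rk_stages_def F_def vec_eq_iff)
    ultimately show ?thesis by simp
  qed
  then show ?thesis using h0 unfolding eventually_nhds_metric S_def by (auto simp: dist_norm)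
qed

lemma rk_stage_branch_exists:
  fixes f :: "real ^ 'n \<Rightarrow> real ^ 'n" and A :: "real ^ 's ^ 's"
  assumes "open U" and cd: "continuously_differentiable_on U f" and "x \<in> U"
  shows "\<exists>G. rk_stage_branch A f x G"
proof -
  obtain r where r: "r > 0" "cball x r \<subseteq> U" using assms open_contains_cball by blast
  define P where "P r h G \<longleftrightarrow> G \<in> {G. \<forall>i. G $ i \<in> cball x r} \<and> rk_stages A f h x G" for r h G
  have ev: "\<forall>\<^sub>F h in nhds 0. \<exists>!G. P \<rho> h G" if "0 < \<rho>" "\<rho> \<le> r" for \<rho>
  proof -
    have "cball x \<rho> \<subseteq> U" using that r by force
    with rk_stages_local[OF cd this that(1)] show ?thesis by (simp add: P_def)
  qed
  define G where "G h = (THE G. P r h G)" for h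
  have G: "\<forall>\<^sub>F h in nhds 0. P r h (G h)"
    using ev[OF r(1) order_refl] by eventually_elim (auto simp: G_def intro: theI')
  have "((\<lambda>h. G h $ i) \<longlongrightarrow> x) (at 0)" for i
  proof (rule tendstoI)
    fix e :: real assume e: "e > 0"
    define \<rho> where "\<rho> = min r (e / 2)"
    have \<rho>: "0 < \<rho>" "\<rho> \<le> r" "\<rho> < e" using e r by (auto simp: \<rho>_def)
    have "\<forall>\<^sub>F h in nhds 0. dist (G h $ i) x < e"
      using ev[OF \<rho>(1,2)] ev[OF r(1) order_refl] G
    proof eventually_elim
      case (elim h)
      then obtain G' where G': "P \<rho> h G'" by blast
      then have "P r h G'" using \<rho>(2) by (auto simp: P_def intro: order_trans)
      with elim have "G h = G'" by blast
      with G' have "dist x (G h $ i) \<le> \<rho>" by (auto simp: P_def)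
      with \<rho> show ?case by (simp add: dist_commute)
    qed
    then show "\<forall>\<^sub>F h in at 0. dist (G h $ i) x < e" by (simp add: eventually_nhds_conv_at)
  qed
  moreover have "\<forall>\<^sub>F h in nhds 0. rk_stages A f h x (G h)"
    using G by eventually_elim (simp add: P_def)
  ultimately show ?thesis unfolding rk_stage_branch_def by blast
qed

lemma rk_stage_branch_unique:
  fixes f :: "real ^ 'n \<Rightarrow> real ^ 'n" and A :: "real ^ 's ^ 's"
  assumes "open U" and cd: "continuously_differentiable_on U f" and "x \<in> U"
    and "rk_stage_branch A f x G" "rk_stage_branch A f x G'"
  shows "\<forall>\<^sub>F h in nhds 0. G h = G' h"
proof -
  obtain r where r: "r > 0" "cball x r \<subseteq> U" using assms open_contains_cball by blast
  have near: "\<forall>\<^sub>F h in nhds 0. H h \<in> {G. \<forall>i. G $ i \<in> cball x r} \<and> rk_stages A f h x (H h)"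
    if H: "rk_stage_branch A f x H" for H
  proof -
    have st: "\<forall>\<^sub>F h in nhds 0. rk_stages A f h x (H h)"
      using H by (simp add: rk_stage_branch_def)
    then have "rk_stages A f 0 x (H 0)" by (rule eventually_nhds_x_imp_x)
    then have H0: "H 0 $ i = x" for i by (simp add: rk_stages_def)
    have "\<forall>\<^sub>F h in nhds 0. H h $ i \<in> cball x r" for i
    proof -
      have "\<forall>\<^sub>F h in at 0. dist (H h $ i) x < r"
        using H r unfolding rk_stage_branch_def by (auto dest: tendstoD)
      then show ?thesis
        unfolding eventually_nhds_conv_at using H0 r
        by (auto simp: dist_commute elim: eventually_mono)
    qed
    then have "\<forall>\<^sub>F h in nhds 0. \<forall>i. H h $ i \<in> cball x r"
      by (intro eventually_all_finite) auto
    with st show ?thesis by eventually_elim simp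
  qed
  from near[OF assms(4)] near[OF assms(5)] rk_stages_local[OF cd r(2,1), of A]
  show ?thesis by eventually_elim blast
qed

lemma rk_method_exists:
  fixes f :: "real ^ 'n \<Rightarrow> real ^ 'n" and A :: "real ^ 's ^ 's"
  assumes "open U" and "continuously_differentiable_on U f"
  shows "\<exists>g \<phi>. rk_method U A b f g \<phi>"
proof -
  have "\<forall>x\<in>U. \<exists>G. rk_stage_branch A f x G" using rk_stage_branch_exists[OF assms] by blast
  then obtain G where "\<forall>x\<in>U. rk_stage_branch A f x (G x)" by metis
  then have "rk_method U A b f (\<lambda>h x. G x h) (\<lambda>h x. rk_step b f h x (G x h))"
    by (simp add: rk_method_def)
  then show ?thesis by blast
qed

lemma rk_method_unique:
  fixes f :: "real ^ 'n \<Rightarrow> real ^ 'n" and A :: "real ^ 's ^ 's"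
  assumes "open U" and "continuously_differentiable_on U f" and "x \<in> U"
    and "rk_method U A b f g \<phi>" "rk_method U A b f g' \<phi>'"
  shows "\<forall>\<^sub>F h in nhds 0. g h x = g' h x \<and> \<phi> h x = \<phi>' h x"
proof -
  have b: "rk_stage_branch A f x (\<lambda>h. g h x)" "rk_stage_branch A f x (\<lambda>h. g' h x)"
    and s: "\<forall>\<^sub>F h in nhds 0. \<phi> h x = rk_step b f h x (g h x)"
           "\<forall>\<^sub>F h in nhds 0. \<phi>' h x = rk_step b f h x (g' h x)"
    using assms(3-5) by (auto simp: rk_method_def)
  from rk_stage_branch_unique[OF assms(1-3) b] s show ?thesis by eventually_elim simp
qed

end

theory Submission
  imports Defs
begin

text \<open>Since \<open>p \<bullet> f y = c y * (p \<bullet> y)\<close>, pairing the stage equations with \<open>p\<close> turns them into the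
  linear system \<open>(I - h A D) u = (p \<bullet> x) 1\<close> for the vector \<open>u\<close> of the numbers \<open>p \<bullet> g\<^sub>i\<close>. For small
  \<open>h\<close> its matrix is invertible because the determinant tends to \<open>1\<close>, and substituting the solution
  into the paired update formula gives the discrete cofactor.\<close>

lemma GDERIV_unique:
  assumes "GDERIV q x :> d" "GDERIV q x :> d'"
  shows "d = d'"
proof -
  have "(\<lambda>y. y \<bullet> d) = (\<lambda>y. y \<bullet> d')"
    using assms unfolding gderiv_def by (rule has_derivative_unique)
  then have "(d - d') \<bullet> d = (d - d') \<bullet> d'" by metis
  then have "(d - d') \<bullet> (d - d') = 0" by (simp add: inner_diff_right)
  then show ?thesis by simp
qed

text \<open>The definition provides only some gradient at each point. Gradients are unique and
  \<open>p\<close> is one of the linear form, so the one provided must be \<open>p\<close>.\<close>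

lemma second_integral_linear:
  assumes "second_integral U f (\<lambda>x. p \<bullet> x) c" "x \<in> U"
  shows "p \<bullet> f x = c x * (p \<bullet> x)"
proof -
  obtain q' where q': "GDERIV (\<lambda>x. p \<bullet> x) x :> q'" "f x \<bullet> q' = c x * (p \<bullet> x)"
    using assms unfolding second_integral_def by blast
  have "GDERIV (\<lambda>x. p \<bullet> x) x :> p"
    unfolding gderiv_def by (auto intro!: derivative_eq_intros simp: inner_commute)
  with q' have "q' = p" by (blast intro: GDERIV_unique)
  with q'(2) show ?thesis by (simp add: inner_commute)
qed

lemma diag_vector_mult: "(diag v *v w) $ i = v $ i * w $ i"
  for v w :: "'a::semiring_1 ^ 's"
  by (simp add: diag_def matrix_vector_mult_def if_distrib[of "\<lambda>a. a * _"] cong: if_cong)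

lemma tendsto_det:
  fixes M :: "'b \<Rightarrow> 'a::{comm_ring_1,real_normed_algebra_1} ^ 's ^ 's"
  assumes "(M \<longlongrightarrow> L) F"
  shows "((\<lambda>h. det (M h)) \<longlongrightarrow> det L) F"
  unfolding det_def using assms by (intro tendsto_intros)

lemma tendsto_matrix_mult:
  fixes M :: "'b \<Rightarrow> 'a::real_normed_algebra_1 ^ 'm ^ 'k" and N :: "'b \<Rightarrow> 'a ^ 'l ^ 'm"
  assumes "(M \<longlongrightarrow> K) F" "(N \<longlongrightarrow> L) F"
  shows "((\<lambda>h. M h ** N h) \<longlongrightarrow> K ** L) F"
  unfolding matrix_matrix_mult_def using assms by (intro tendsto_intros)

lemma tendsto_stage_diag:
  assumes "\<And>i. ((\<lambda>h. c (G h $ i)) \<longlongrightarrow> d $ i) F"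
  shows "((\<lambda>h. stage_diag c (G h)) \<longlongrightarrow> diag d) F"
proof -
  have "((\<lambda>h. if i = j then c (G h $ i) else 0) \<longlongrightarrow> (if i = j then d $ i else 0)) F" for i j
    using assms by (cases "i = j") auto
  then show ?thesis
    unfolding stage_diag_def diag_def vec_lambda_beta by (intro tendsto_vec_lambda)
qed

text \<open>The matrix \<open>B h\<close> may vary with \<open>h\<close>, as the stages do. Its
  convergence suffices: the factor \<open>h\<close> removes the limit \<open>L\<close>, so the
  matrix tends to the identity.\<close>

lemma eventually_invertible_mat_1_minus:
  fixes B :: "real \<Rightarrow> real ^ 's ^ 's"
  assumes "(B \<longlongrightarrow> L) (nhds 0)"
  shows "\<forall>\<^sub>F h in nhds 0. invertible (mat 1 - h *\<^sub>R B h)"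
proof -
  have "((\<lambda>h. h) \<longlongrightarrow> 0) (nhds (0::real))" by (rule filterlim_ident)
  with assms have "((\<lambda>h. mat 1 - h *\<^sub>R B h) \<longlongrightarrow> mat 1 - 0 *\<^sub>R L) (nhds 0)"
    by (intro tendsto_intros)
  then have "((\<lambda>h. det (mat 1 - h *\<^sub>R B h)) \<longlongrightarrow> 1) (nhds 0)"
    by (auto dest!: tendsto_det)
  then have "\<forall>\<^sub>F h in nhds 0. det (mat 1 - h *\<^sub>R B h) \<noteq> 0"
    by (rule tendsto_imp_eventually_ne) simp
  then show ?thesis by (simp add: invertible_det_nz)
qed

lemma continuously_differentiable_on_imp_isCont:
  "continuously_differentiable_on U f \<Longrightarrow> x \<in> U \<Longrightarrow> isCont f x"
  unfolding continuously_differentiable_on_def by (blast intro: has_derivative_continuous)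

text \<open>The branch prescribes a limit only at the punctured point \<open>0\<close>. The stage
  equations hold on a full neighbourhood, hence also at \<open>h = 0\<close>, where they force every
  stage to equal \<open>x\<close>.\<close>

lemma rk_stage_branch_tendsto_nhds:
  assumes "rk_stage_branch A f x G"
  shows "((\<lambda>h. G h $ i) \<longlongrightarrow> x) (nhds 0)"
proof -
  have "\<forall>\<^sub>F h in nhds 0. rk_stages A f h x (G h)" and lim: "((\<lambda>h. G h $ i) \<longlongrightarrow> x) (at 0)"
    using assms by (auto simp: rk_stage_branch_def)
  then have "rk_stages A f 0 x (G 0)" by (blast dest: eventually_nhds_x_imp_x)
  then have "G 0 $ i = x" by (simp add: rk_stages_def)
  with lim show ?thesis by (auto simp: tendsto_def eventually_nhds_conv_at)
qed

text \<open>This is the algebraic core for a single fixed \<open>h\<close>; smallness of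
  \<open>h\<close> enters only through invertibility, and the cofactor identity is needed only at
  the stages.\<close>

lemma rk_step_discrete_cofactor:
  fixes A :: "real ^ 's ^ 's"
  assumes stages: "rk_stages A f h x G"
    and cofactor: "\<And>i. p \<bullet> f (G $ i) = c (G $ i) * (p \<bullet> G $ i)"
    and inv: "invertible (mat 1 - h *\<^sub>R (A ** stage_diag c G))"
  shows "p \<bullet> rk_step b f h x G = discrete_cofactor A b c h G * (p \<bullet> x)"
proof -
  define D where "D = stage_diag c G"
  define M where "M = mat 1 - h *\<^sub>R (A ** D)"
  define u where "u = (\<chi> i. p \<bullet> G $ i)"
  \<comment> \<open>The vector \<open>D *v u\<close> collects the numbers
    \<open>p \<bullet> f (G $ j)\<close>, which occur in both the stage equations and the
    update.\<close>
  have Du: "(D *v u) $ j = p \<bullet> f (G $ j)" for j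
    by (simp add: D_def stage_diag_def diag_vector_mult u_def cofactor)
  have "u $ i = p \<bullet> x + h * (A *v (D *v u)) $ i" for i
  proof -
    have "u $ i = p \<bullet> (x + h *\<^sub>R (\<Sum>j\<in>UNIV. A $ i $ j *\<^sub>R f (G $ j)))"
      unfolding u_def vec_lambda_beta using stages unfolding rk_stages_def by metis
    then show ?thesis
      by (simp add: inner_add_right inner_sum_right matrix_vector_mult_def[of A] Du)
  qed
  then have "M *v u = (p \<bullet> x) *\<^sub>R 1"
    by (simp add: M_def vec_eq_iff matrix_vector_mult_diff_rdistrib
        scaleR_matrix_vector_assoc[symmetric] matrix_vector_mul_assoc[symmetric])
  \<comment> \<open>Since \<open>matrix_inv\<close> is a choice of two-sided inverse, invertibility
    ensures that the chosen matrix is one.\<close>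
  moreover have "matrix_inv M ** M = mat 1"
    using inv someI_ex[of "\<lambda>N. M ** N = mat 1 \<and> N ** M = mat 1"]
    by (simp add: invertible_def matrix_inv_def M_def D_def)
  ultimately have "u = (p \<bullet> x) *\<^sub>R (matrix_inv M *v 1)"
    by (metis matrix_vector_mul_assoc matrix_vector_mul_lid matrix_vector_mult_scaleR)
  then have "b \<bullet> (D *v u) = (p \<bullet> x) * (b \<bullet> (D *v (matrix_inv M *v 1)))"
    by (simp add: matrix_vector_mult_scaleR)
  moreover have "p \<bullet> rk_step b f h x G = p \<bullet> x + h * (b \<bullet> (D *v u))"
    by (simp add: rk_step_def inner_add_right inner_sum_right inner_vec_def[of b] Du)
  ultimately show ?thesis
    by (simp add: discrete_cofactor_def M_def D_def algebra_simps)
qed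

theorem theorem2:
  fixes f :: "real ^ 'n \<Rightarrow> real ^ 'n" and c :: "real ^ 'n \<Rightarrow> real"
    and U :: "(real ^ 'n) set" and p :: "real ^ 'n"
    and A :: "real ^ 's ^ 's" and b :: "real ^ 's"
    and g :: "real \<Rightarrow> real ^ 'n \<Rightarrow> real ^ 'n ^ 's"
    and \<phi> :: "real \<Rightarrow> real ^ 'n \<Rightarrow> real ^ 'n"
  assumes "open U"
    and "continuously_differentiable_on U f"
    and "continuously_differentiable_on U c"
    and "second_integral U f (\<lambda>x. p \<bullet> x) c"
    and "rk_method U A b f g \<phi>"
  shows "\<forall>x\<in>U. \<forall>\<^sub>F h in nhds 0.
           (\<forall>i. g h x $ i \<in> U) \<and>
           invertible (mat 1 - h *\<^sub>R (A ** stage_diag c (g h x))) \<and>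
           p \<bullet> \<phi> h x = discrete_cofactor A b c h (g h x) * (p \<bullet> x)"
proof
  fix x assume x: "x \<in> U"
  have branch: "rk_stage_branch A f x (\<lambda>h. g h x)"
    and step: "\<forall>\<^sub>F h in nhds 0. \<phi> h x = rk_step b f h x (g h x)"
    using assms(5) x by (auto simp: rk_method_def)
  have stages: "\<forall>\<^sub>F h in nhds 0. rk_stages A f h x (g h x)"
    using branch by (simp add: rk_stage_branch_def)
  have lim: "((\<lambda>h. g h x $ i) \<longlongrightarrow> x) (nhds 0)" for i
    using rk_stage_branch_tendsto_nhds[OF branch] .
  have in_U: "\<forall>\<^sub>F h in nhds 0. \<forall>i. g h x $ i \<in> U"
    using topological_tendstoD[OF lim assms(1) x] by (intro eventually_all_finite) auto
  \<comment> \<open>All stages tend to the same point \<open>x\<close>, so by continuity of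
    \<open>c\<close> the diagonal matrix tends to the one with constant diagonal
    \<open>c x\<close>.\<close>
  have "((\<lambda>h. c (g h x $ i)) \<longlongrightarrow> (\<chi> i. c x) $ i) (nhds 0)" for i
    using isCont_tendsto_compose[OF continuously_differentiable_on_imp_isCont[OF assms(3) x] lim]
    by simp
  then have "((\<lambda>h. A ** stage_diag c (g h x)) \<longlongrightarrow> A ** diag (\<chi> i. c x)) (nhds 0)"
    by (intro tendsto_matrix_mult tendsto_const tendsto_stage_diag)
  \<comment> \<open>On a common neighbourhood of \<open>0\<close> all four conditions hold;
    \<open>in_U\<close> makes the cofactor identity available at every stage.\<close>
  from in_U eventually_invertible_mat_1_minus[OF this] stages step
  show "\<forall>\<^sub>F h in nhds 0.
           (\<forall>i. g h x $ i \<in> U) \<and>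
           invertible (mat 1 - h *\<^sub>R (A ** stage_diag c (g h x))) \<and>
           p \<bullet> \<phi> h x = discrete_cofactor A b c h (g h x) * (p \<bullet> x)"
    by eventually_elim
      (simp add: rk_step_discrete_cofactor second_integral_linear[OF assms(4)])
qed

end
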